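(* In the setting of the context, let $u:[\alpha,+\infty)\to\mathbb R$ be a solution of $u'(t)=a\,u(t)+b\max_{s\in[t-h,t]}u(s)+f(t)$ (the equation being satisfied for $t\ge\alpha+h$). Then the set of all points $\tau>\alpha+h$ for which there exists $\varepsilon>0$ with $\max_{s\in[\tau-h,\tau+\varepsilon]}u(s)=u(\tau)$ forms a strictly increasing unbounded sequence $\{\tau_j,\ j\in\mathbb N\}$. Furthermore, $u(\tau_{n+j})=\mathcal R^j(u(\tau_n))$ for all $j\ge0$ and $n\ge1$.
   Context: Setting. $a,b\in\mathbb R$, $0<h<T$, and either ($a+b<0$ and $ah\le1$) or ($bh<-e^{ah-1}$ and $ah\ge1$); each case implies $a+b<0$. $f:\mathbb R\to\mathbb R$ is continuous and $T$-periodic, and there is $\beta\in(0,T)$ such that $f$ is strictly decreasing on $[0,\beta]$, strictly increasing on $[\beta,T]$, and $\min f=0$. Put $\tilde f=f/|a+b|$ and $K=\tilde f([0,\beta])=[0,\max\tilde f]$. Return map. For $p\in K$ let $q=q(p)\in[0,\beta]$ be the unique point with $\tilde f(q)=p$, and let $u(\cdot,p)$ be the solution of the equation for $t\ge q$ with $u(s,p)=p$ for $s\in[q-h,q]$. Let $\nu^*=\nu^*(q)$ be the smallest $\nu>q$ for which there is $\varepsilon>0$ with $u(\nu,p)=\max_{r\in[\nu-h,\nu+\varepsilon]}u(r,p)$ (such $\nu$ exists). Set $\mathcal R(p)=u(\nu^*,p)$; $\mathcal R$ maps $K$ into $K$, and $\mathcal R^j$ is its $j$-th iterate. *)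

theory Defs
  imports "HOL-Analysis.Analysis"
begin

(* Functions on a half line [alpha, oo) are represented by total functions; only their values on
   the half line are constrained. The maxima over compact intervals are written as suprema, which
   are attained because u is continuous there. At the initial time alpha + h the derivative is the
   one-sided derivative from the right. *)
definition is_solution ::
    "real \<Rightarrow> real \<Rightarrow> real \<Rightarrow> (real \<Rightarrow> real) \<Rightarrow> real \<Rightarrow> (real \<Rightarrow> real) \<Rightarrow> bool" where
  "is_solution a b h f \<alpha> u \<longleftrightarrow>
     continuous_on {\<alpha>..} u \<and>
     (\<forall>t\<ge>\<alpha> + h. (u has_real_derivative a * u t + b * (SUP s\<in>{t - h..t}. u s) + f t)
                   (at t within {\<alpha> + h..}))"

definition window_peak :: "real \<Rightarrow> (real \<Rightarrow> real) \<Rightarrow> real \<Rightarrow> bool" where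
  "window_peak h u \<tau> \<longleftrightarrow> (\<exists>\<epsilon>>0. (SUP s\<in>{\<tau> - h..\<tau> + \<epsilon>}. u s) = u \<tau>)"

definition f_tilde :: "real \<Rightarrow> real \<Rightarrow> (real \<Rightarrow> real) \<Rightarrow> real \<Rightarrow> real" where
  "f_tilde a b f t = f t / \<bar>a + b\<bar>"

definition K_set :: "real \<Rightarrow> real \<Rightarrow> (real \<Rightarrow> real) \<Rightarrow> real \<Rightarrow> real set" where
  "K_set a b f \<beta> = f_tilde a b f ` {0..\<beta>}"

definition start_point :: "real \<Rightarrow> real \<Rightarrow> (real \<Rightarrow> real) \<Rightarrow> real \<Rightarrow> real \<Rightarrow> real" where
  "start_point a b f \<beta> p = (THE q. q \<in> {0..\<beta>} \<and> f_tilde a b f q = p)"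

(* The initial value problem determines the solution only on [q - h, oo), so a total function
   representing it is not unique and has to be chosen; the values on that half line, the only ones
   used below, do not depend on the choice. *)
definition const_sol ::
    "real \<Rightarrow> real \<Rightarrow> real \<Rightarrow> (real \<Rightarrow> real) \<Rightarrow> real \<Rightarrow> real \<Rightarrow> real \<Rightarrow> real" where
  "const_sol a b h f \<beta> p =
     (let q = start_point a b f \<beta> p
      in SOME u. is_solution a b h f (q - h) u \<and> (\<forall>s\<in>{q - h..q}. u s = p))"

definition first_peak ::
    "real \<Rightarrow> real \<Rightarrow> real \<Rightarrow> (real \<Rightarrow> real) \<Rightarrow> real \<Rightarrow> real \<Rightarrow> real" where
  "first_peak a b h f \<beta> p =
     (LEAST \<nu>. \<nu> > start_point a b f \<beta> p \<and> window_peak h (const_sol a b h f \<beta> p) \<nu>)"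

(* Meaningful for p in K_set a b f beta only. *)
definition return_map ::
    "real \<Rightarrow> real \<Rightarrow> real \<Rightarrow> (real \<Rightarrow> real) \<Rightarrow> real \<Rightarrow> real \<Rightarrow> real" where
  "return_map a b h f \<beta> p = const_sol a b h f \<beta> p (first_peak a b h f \<beta> p)"

end

theory Submission
  imports Defs "HOL-Real_Asymp.Real_Asymp"
begin

text \<open>
  At a peak \<open>\<tau>\<close> the window maximum is \<open>u \<tau>\<close> and the derivative vanishes, so
  \<open>u \<tau> = f \<tau> / \<bar>a + b\<bar>\<close>. Just after \<open>\<tau>\<close> the window maximum is still \<open>u \<tau>\<close>, and the equation reads
  \<open>u' = a (u - u \<tau>) + (f - f \<tau>)\<close>: the solution leaves the value \<open>u \<tau>\<close> in the direction in which
  \<open>f\<close> leaves \<open>f \<tau>\<close>. Hence \<open>\<tau>\<close> is, modulo \<open>T\<close>, a point of \<open>[0, \<beta>)\<close>, where \<open>f\<close> falls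
  (\<open>peak_phase\<close>), and the peak value determines that point. As the solution then stays below
  \<open>u \<tau>\<close> until the peak leaves the window or \<open>f\<close> stops falling, peaks are uniformly separated
  (\<open>peak_gap\<close>) and form a sequence as soon as there are arbitrarily late ones.

  Before the peak the solution is at most \<open>u \<tau>\<close>. Replacing this history by the constant \<open>u \<tau>\<close>
  changes no later window maximum, so, up to a shift by periods, the solution continues as the
  one that defines the return map (\<open>const_sol_after_peak\<close>, by uniqueness for the initial value
  problem), and its next peak is the first peak of the latter (\<open>return_map_next_peak\<close>).

  Existence of late peaks is where the conditions on \<open>a\<close>, \<open>b\<close>, \<open>h\<close> enter. If there were none after
  \<open>t\<^sub>0\<close>, then a single later time at which the solution equals its window maximum would make it
  nondecreasing from then on, since any later maximum that is not renewed at once is a peak; but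
  \<open>u' = (a + b) u + f \<ge> 0\<close> forces \<open>u \<le> 0\<close> through the zeros of \<open>f\<close>, and then \<open>u' \<ge> f\<close> lets \<open>u\<close>
  grow by a fixed amount in each period (\<open>peak_after\<close>). If on the other hand \<open>u\<close> stays strictly
  below its window maximum \<open>M\<close>, then \<open>M\<close> is nonincreasing. It cannot become negative, because the
  characteristic function of the linear delay equation has no nonnegative root
  (\<open>window_max_nonneg_of_below\<close>). So \<open>M\<close> has a limit \<open>L\<close>, and translates of \<open>u\<close> by periods
  accumulate at solutions below \<open>L\<close> that touch \<open>L\<close> in every window of length \<open>h\<close>
  (\<open>limit_touches_in_window\<close>). As for peaks, a touching point lies in a falling phase of \<open>f\<close> and is
  determined by \<open>L\<close> modulo \<open>T\<close>. As \<open>h < T\<close>, some window of length \<open>h\<close> contains no such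
  point (\<open>window_max_touched\<close>).
\<close>

section \<open>Maxima over a sliding window\<close>

definition window_max :: "real \<Rightarrow> (real \<Rightarrow> real) \<Rightarrow> real \<Rightarrow> real" where
  "window_max h u t = (SUP s\<in>{t - h..t}. u s)"

lemma SUP_eq_attained:
  fixes u :: "real \<Rightarrow> real"
  assumes "r \<in> S" "\<And>s. s \<in> S \<Longrightarrow> u s \<le> u r"
  shows "(SUP s\<in>S. u s) = u r"
  using assms by (intro cSup_eq_maximum) auto

lemma window_max_eqI:
  assumes "r \<in> {t - h..t}" "\<And>s. s \<in> {t - h..t} \<Longrightarrow> u s \<le> u r"
  shows "window_max h u t = u r"
  unfolding window_max_def using assms by (rule SUP_eq_attained)

lemma window_max_attained:
  assumes "continuous_on {\<alpha>..} u" "\<alpha> \<le> t - h" "0 < h"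
  obtains r where "r \<in> {t - h..t}" "window_max h u t = u r"
    "\<And>s. s \<in> {t - h..t} \<Longrightarrow> u s \<le> window_max h u t"
proof -
  have "continuous_on {t - h..t} u"
    using assms by (auto intro: continuous_on_subset)
  then obtain r where r: "r \<in> {t - h..t}" "\<And>s. s \<in> {t - h..t} \<Longrightarrow> u s \<le> u r"
    using continuous_attains_sup[of "{t - h..t}" u] assms by auto
  then show ?thesis
    using that[of r] window_max_eqI[of r t h u] by auto
qed

lemma window_max_ge:
  assumes "continuous_on {\<alpha>..} u" "\<alpha> \<le> t - h" "0 < h" "s \<in> {t - h..t}"
  shows "u s \<le> window_max h u t"
  using window_max_attained[OF assms(1-3)] assms(4) by metis

lemma window_peak_iff:
  assumes "continuous_on {\<alpha>..} u" "\<alpha> \<le> \<tau> - h" "0 < h"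
  shows "window_peak h u \<tau> \<longleftrightarrow> (\<exists>\<epsilon>>0. \<forall>s\<in>{\<tau> - h..\<tau> + \<epsilon>}. u s \<le> u \<tau>)"
proof -
  have "(SUP s\<in>{\<tau> - h..\<tau> + \<epsilon>}. u s) = u \<tau> \<longleftrightarrow> (\<forall>s\<in>{\<tau> - h..\<tau> + \<epsilon>}. u s \<le> u \<tau>)"
    if "0 < \<epsilon>" for \<epsilon>
  proof
    assume eq: "(SUP s\<in>{\<tau> - h..\<tau> + \<epsilon>}. u s) = u \<tau>"
    have "continuous_on {\<tau> - h..\<tau> + \<epsilon>} u"
      using assms by (auto intro: continuous_on_subset)
    then have "bdd_above (u ` {\<tau> - h..\<tau> + \<epsilon>})"
      by (intro bounded_imp_bdd_above compact_imp_bounded compact_continuous_image) auto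
    then show "\<forall>s\<in>{\<tau> - h..\<tau> + \<epsilon>}. u s \<le> u \<tau>"
      unfolding eq[symmetric] by (auto intro: cSUP_upper)
  next
    assume "\<forall>s\<in>{\<tau> - h..\<tau> + \<epsilon>}. u s \<le> u \<tau>"
    then show "(SUP s\<in>{\<tau> - h..\<tau> + \<epsilon>}. u s) = u \<tau>"
      using that assms by (intro SUP_eq_attained) auto
  qed
  then show ?thesis
    unfolding window_peak_def by metis
qed

section \<open>Solutions and their uniqueness\<close>

lemma is_solution_continuous: "is_solution a b h f \<alpha> u \<Longrightarrow> continuous_on {\<alpha>..} u"
  by (simp add: is_solution_def)

lemma is_solution_deriv:
  assumes "is_solution a b h f \<alpha> u" "\<alpha> + h < t"
  shows "(u has_real_derivative a * u t + b * window_max h u t + f t) (at t)"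
proof -
  have "(u has_real_derivative a * u t + b * window_max h u t + f t) (at t within {\<alpha> + h..})"
    using assms by (auto simp: is_solution_def window_max_def)
  moreover have "at t within {\<alpha> + h..} = at t"
    using assms by (intro at_within_interior) auto
  ultimately show ?thesis by simp
qed

lemma window_max_diff_le:
  assumes "continuous_on {\<alpha>..} u" "continuous_on {\<alpha>..} v" "\<alpha> \<le> t - h" "0 < h"
    and "\<And>s. s \<in> {t - h..t} \<Longrightarrow> \<bar>u s - v s\<bar> \<le> D"
  shows "\<bar>window_max h u t - window_max h v t\<bar> \<le> D"
proof -
  obtain r where r: "r \<in> {t - h..t}" "window_max h u t = u r"
      "\<And>s. s \<in> {t - h..t} \<Longrightarrow> u s \<le> window_max h u t"
    using window_max_attained[OF assms(1,3,4)] by metis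
  obtain r' where r': "r' \<in> {t - h..t}" "window_max h v t = v r'"
      "\<And>s. s \<in> {t - h..t} \<Longrightarrow> v s \<le> window_max h v t"
    using window_max_attained[OF assms(2,3,4)] by metis
  show ?thesis
    using r(2) r'(2) r(3)[OF r'(1)] r'(3)[OF r(1)] assms(5)[OF r(1)] assms(5)[OF r'(1)]
    by linarith
qed

text \<open>Over a time step shorter than \<open>1 / (\<bar>a\<bar> + \<bar>b\<bar>)\<close> the right-hand side is a contraction
  in the supremum norm, so equality propagates from step to step.\<close>
lemma solution_unique_step:
  assumes u: "is_solution a b h f \<alpha> u" and v: "is_solution a b h f \<alpha> v"
    and "0 < h" and t0: "\<alpha> + h \<le> t0"
    and eq: "\<And>s. s \<in> {\<alpha>..t0} \<Longrightarrow> u s = v s"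
    and \<delta>: "0 < \<delta>" "(\<bar>a\<bar> + \<bar>b\<bar>) * \<delta> \<le> 1 / 2"
    and t: "t \<in> {\<alpha>..t0 + \<delta>}"
  shows "u t = v t"
proof -
  note cu = is_solution_continuous[OF u] and cv = is_solution_continuous[OF v]
  define d where "d s = u s - v s" for s
  have cd: "continuous_on {t0..t0 + \<delta>} d"
    unfolding d_def using t0 \<open>0 < h\<close>
    by (intro continuous_intros continuous_on_subset[OF cu] continuous_on_subset[OF cv]) auto
  then have "continuous_on {t0..t0 + \<delta>} (\<lambda>s. \<bar>d s\<bar>)"
    by (intro continuous_intros)
  then obtain x where x: "x \<in> {t0..t0 + \<delta>}" "\<And>s. s \<in> {t0..t0 + \<delta>} \<Longrightarrow> \<bar>d s\<bar> \<le> \<bar>d x\<bar>"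
    using continuous_attains_sup[of "{t0..t0 + \<delta>}" "\<lambda>s. \<bar>d s\<bar>"] \<delta> by auto
  have "d x = 0"
  proof (cases "x = t0")
    case True
    then show ?thesis using eq t0 \<open>0 < h\<close> by (auto simp: d_def)
  next
    case False
    then have "t0 < x" using x by auto
    have deriv: "(d has_real_derivative a * d s + b * (window_max h u s - window_max h v s)) (at s)"
      if "t0 < s" for s
      unfolding d_def using that t0
      by (auto intro!: derivative_eq_intros is_solution_deriv[OF u] is_solution_deriv[OF v]
          simp: algebra_simps)
    have "\<exists>l z. t0 < z \<and> z < x \<and> (d has_real_derivative l) (at z) \<and> d x - d t0 = (x - t0) * l"
      using x \<open>t0 < x\<close> deriv
      by (intro MVT continuous_on_subset[OF cd]) (auto simp: real_differentiable_def)
    then obtain l z where z: "t0 < z" "z < x" "(d has_real_derivative l) (at z)"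
        and mv: "d x - d t0 = (x - t0) * l"
      by blast
    have l: "l = a * d z + b * (window_max h u z - window_max h v z)"
      using DERIV_unique z deriv by blast
    have "\<bar>u s - v s\<bar> \<le> \<bar>d x\<bar>" if "s \<in> {z - h..z}" for s
      using that x(2)[of s] eq[of s] z x t0 by (cases "s \<le> t0") (auto simp: d_def)
    then have "\<bar>window_max h u z - window_max h v z\<bar> \<le> \<bar>d x\<bar>"
      using z t0 \<open>0 < h\<close> by (intro window_max_diff_le[OF cu cv]) auto
    moreover have "\<bar>d z\<bar> \<le> \<bar>d x\<bar>" using x z by auto
    ultimately have "\<bar>a * d z\<bar> + \<bar>b * (window_max h u z - window_max h v z)\<bar>
        \<le> \<bar>a\<bar> * \<bar>d x\<bar> + \<bar>b\<bar> * \<bar>d x\<bar>"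
      unfolding abs_mult by (intro add_mono mult_left_mono) auto
    then have "\<bar>l\<bar> \<le> \<bar>a\<bar> * \<bar>d x\<bar> + \<bar>b\<bar> * \<bar>d x\<bar>"
      unfolding l by linarith
    then have "\<bar>l\<bar> \<le> (\<bar>a\<bar> + \<bar>b\<bar>) * \<bar>d x\<bar>"
      by (simp add: algebra_simps)
    then have "(x - t0) * \<bar>l\<bar> \<le> \<delta> * ((\<bar>a\<bar> + \<bar>b\<bar>) * \<bar>d x\<bar>)"
      using x \<delta> by (intro mult_mono) auto
    moreover have "d t0 = 0" using eq t0 \<open>0 < h\<close> by (auto simp: d_def)
    then have "\<bar>d x\<bar> = (x - t0) * \<bar>l\<bar>"
      using mv \<open>t0 < x\<close> by (simp add: abs_mult)
    ultimately have "\<bar>d x\<bar> \<le> \<delta> * ((\<bar>a\<bar> + \<bar>b\<bar>) * \<bar>d x\<bar>)" by simp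
    also have "\<dots> \<le> 1 / 2 * \<bar>d x\<bar>"
      using mult_right_mono[OF \<delta>(2), of "\<bar>d x\<bar>"] by (simp add: algebra_simps)
    finally show ?thesis by simp
  qed
  then show ?thesis
    using x(2)[of t] eq[of t] t by (cases "t \<le> t0") (auto simp: d_def)
qed

lemma solution_unique:
  assumes u: "is_solution a b h f \<alpha> u" and v: "is_solution a b h f \<alpha> v"
    and "0 < h" and eq: "\<And>s. s \<in> {\<alpha>..\<alpha> + h} \<Longrightarrow> u s = v s" and "\<alpha> \<le> t"
  shows "u t = v t"
proof -
  define \<delta> where "\<delta> = 1 / (2 * (\<bar>a\<bar> + \<bar>b\<bar> + 1))"
  have \<delta>: "0 < \<delta>" "(\<bar>a\<bar> + \<bar>b\<bar>) * \<delta> \<le> 1 / 2"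
    unfolding \<delta>_def by (auto simp: field_simps)
  have steps: "\<forall>s\<in>{\<alpha>..\<alpha> + h + of_nat n * \<delta>}. u s = v s" for n
  proof (induction n)
    case 0
    then show ?case using eq by simp
  next
    case (Suc n)
    have "u s = v s" if "s \<in> {\<alpha>..(\<alpha> + h + of_nat n * \<delta>) + \<delta>}" for s
      using that Suc \<delta> \<open>0 < h\<close>
      by (intro solution_unique_step[OF u v \<open>0 < h\<close>, of "\<alpha> + h + of_nat n * \<delta>" \<delta> s]) auto
    then show ?case by (auto simp: algebra_simps)
  qed
  obtain n where "(t - \<alpha> - h) / \<delta> < of_nat n" using reals_Archimedean2 by blast
  then have "t \<le> \<alpha> + h + of_nat n * \<delta>" using \<delta> by (simp add: field_simps)
  then show ?thesis using steps[of n] \<open>\<alpha> \<le> t\<close> by auto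
qed

section \<open>The scalar equation below its initial value\<close>

text \<open>Multiplying by the integrating factor \<open>exp (- a * s)\<close> removes the linear term, so
  the sign of \<open>g\<close> decides on which side of its initial value the solution runs.\<close>
lemma below_initial_value:
  fixes y :: "real \<Rightarrow> real"
  assumes "r < t" "continuous_on {r..t} y"
    and deriv: "\<And>s. r < s \<Longrightarrow> s < t \<Longrightarrow> (y has_real_derivative a * (y s - y r) + g s) (at s)"
    and neg: "\<And>s. r < s \<Longrightarrow> s < t \<Longrightarrow> g s < 0"
  shows "y t < y r"
proof -
  define z where "z s = exp (- a * s) * (y s - y r)" for s
  have "z t < z r"
  proof (rule DERIV_neg_imp_decreasing_open[OF \<open>r < t\<close>])
    fix s assume s: "r < s" "s < t"
    have "(z has_real_derivative exp (- a * s) * g s) (at s)"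
      unfolding z_def by (auto intro!: derivative_eq_intros deriv[OF s] simp: algebra_simps)
    then show "\<exists>l. (z has_real_derivative l) (at s) \<and> l < 0"
      using neg[OF s] by (intro exI[of _ "exp (- a * s) * g s"]) (auto simp: mult_less_0_iff)
  next
    show "continuous_on {r..t} z"
      unfolding z_def by (intro continuous_intros assms)
  qed
  then show ?thesis by (simp add: z_def mult_less_0_iff)
qed

lemma above_initial_value:
  fixes y :: "real \<Rightarrow> real"
  assumes "r < t" "continuous_on {r..t} y"
    and deriv: "\<And>s. r < s \<Longrightarrow> s < t \<Longrightarrow> (y has_real_derivative a * (y s - y r) + g s) (at s)"
    and pos: "\<And>s. r < s \<Longrightarrow> s < t \<Longrightarrow> 0 < g s"
  shows "y r < y t"
proof -
  have "- y t < - y r"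
  proof (rule below_initial_value[of r t "\<lambda>s. - y s" a "\<lambda>s. - g s"])
    show "((\<lambda>s. - y s) has_real_derivative a * (- y s - - y r) + - g s) (at s)"
      if "r < s" "s < t" for s
      using DERIV_minus[OF deriv[OF that]] by (simp add: algebra_simps)
  qed (use assms in \<open>auto intro: continuous_on_minus\<close>)
  then show ?thesis by simp
qed

section \<open>Enumerating a uniformly discrete set of reals\<close>

lemma gap_set_has_least:
  fixes P :: "real set"
  assumes "0 < g" and gap: "\<And>s t. s \<in> P \<Longrightarrow> t \<in> P \<Longrightarrow> s < t \<Longrightarrow> g \<le> t - s"
    and "bdd_below P" "P \<noteq> {}"
  shows "\<exists>x\<in>P. \<forall>y\<in>P. x \<le> y"
proof -
  obtain x where x: "x \<in> P" "x < Inf P + g"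
    using cInf_lessD[of P "Inf P + g"] assms by auto
  have "x \<le> y" if "y \<in> P" for y
  proof (rule ccontr)
    assume "\<not> x \<le> y"
    then have "g \<le> x - y" using gap that x by auto
    moreover have "Inf P \<le> y" using that assms by (auto intro: cInf_lower)
    ultimately show False using x by linarith
  qed
  then show ?thesis using x by blast
qed

lemma gap_set_enumeration:
  fixes P :: "real set"
  assumes "0 < g" and gap: "\<And>s t. s \<in> P \<Longrightarrow> t \<in> P \<Longrightarrow> s < t \<Longrightarrow> g \<le> t - s"
    and "bdd_below P" and unbounded: "\<And>t. \<exists>x\<in>P. t < x"
  shows "\<exists>\<sigma>::nat \<Rightarrow> real. strict_mono \<sigma> \<and> range \<sigma> = P"
proof -
  have "\<exists>x\<in>P. t < x \<and> (\<forall>y\<in>P. t < y \<longrightarrow> x \<le> y)" for t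
  proof -
    have "\<exists>x\<in>{x\<in>P. t < x}. \<forall>y\<in>{x\<in>P. t < x}. x \<le> y"
      by (rule gap_set_has_least[OF \<open>0 < g\<close>])
        (use gap unbounded[of t] in \<open>auto intro: bdd_belowI[of _ t]\<close>)
    then show ?thesis by auto
  qed
  then obtain nxt where nxt: "\<And>t. nxt t \<in> P" "\<And>t. t < nxt t"
      "\<And>t y. y \<in> P \<Longrightarrow> t < y \<Longrightarrow> nxt t \<le> y"
    by metis
  have "P \<noteq> {}" using unbounded by auto
  then obtain x0 where x0: "x0 \<in> P" "\<And>y. y \<in> P \<Longrightarrow> x0 \<le> y"
    using gap_set_has_least[OF assms(1-3)] by blast
  define \<sigma> where "\<sigma> n = (nxt ^^ n) x0" for n
  have \<sigma>_Suc: "\<sigma> (Suc n) = nxt (\<sigma> n)" for n by (simp add: \<sigma>_def)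
  have \<sigma>_P: "\<sigma> n \<in> P" for n using nxt x0 by (induction n) (auto simp: \<sigma>_def)
  have mono: "strict_mono \<sigma>"
    by (rule strict_monoI_Suc) (simp add: \<sigma>_Suc nxt)
  have grow: "x0 + of_nat n * g \<le> \<sigma> n" for n
  proof (induction n)
    case (Suc n)
    have "g \<le> \<sigma> (Suc n) - \<sigma> n" using gap[OF \<sigma>_P \<sigma>_P, of n "Suc n"] nxt(2) \<sigma>_Suc by simp
    then show ?case using Suc by (simp add: algebra_simps)
  qed (simp add: \<sigma>_def)
  have "t \<in> range \<sigma>" if "t \<in> P" for t
  proof -
    obtain n where "(t - x0) / g < of_nat n" using reals_Archimedean2 by blast
    then have "t \<le> \<sigma> n" using grow[of n] \<open>0 < g\<close> by (simp add: field_simps)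
    then have least: "t \<le> \<sigma> (LEAST n. t \<le> \<sigma> n)" by (rule LeastI)
    show ?thesis
    proof (cases "LEAST n. t \<le> \<sigma> n")
      case 0
      then have "t = \<sigma> 0" using least x0(2)[OF that] by (simp add: \<sigma>_def)
      then show ?thesis by simp
    next
      case (Suc m)
      then have "\<sigma> m < t" using not_less_Least[of m "\<lambda>n. t \<le> \<sigma> n"] by simp
      then have "t = \<sigma> (Suc m)" using least Suc nxt(3)[OF that] \<sigma>_Suc by fastforce
      then show ?thesis by simp
    qed
  qed
  then show ?thesis using mono \<sigma>_P by (intro exI[of _ \<sigma>]) auto
qed

section \<open>The equation and its forcing term\<close>

locale max_equation =
  fixes a b h T \<beta> :: real and f :: "real \<Rightarrow> real"
  assumes h: "0 < h" "h < T"
    and stable: "(a + b < 0 \<and> a * h \<le> 1) \<or> (b * h < - exp (a * h - 1) \<and> a * h \<ge> 1)"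
    and f_cont: "continuous_on UNIV f"
    and f_periodic: "f (t + T) = f t"
    and \<beta>: "0 < \<beta>" "\<beta> < T"
    and f_falls: "strict_antimono_on {0..\<beta>} f"
    and f_rises: "strict_mono_on {\<beta>..T} f"
    and f_zero: "\<exists>t. f t = 0"
    and f_nonneg: "0 \<le> f t"
begin

lemma T_pos: "0 < T"
  using h by linarith

lemma f_shift: "f (t + of_int k * T) = f t"
proof -
  have nat: "f (t + of_nat n * T) = f t" for n t
  proof (induction n)
    case (Suc n)
    then show ?case using f_periodic[of "t + of_nat n * T"] by (simp add: algebra_simps)
  qed simp
  show ?thesis
  proof (cases k)
    case (nonneg n)
    then show ?thesis using nat by simp
  next
    case (neg n)
    then have k: "real_of_int k = - (1 + of_nat n)" by simp
    have eq: "t + of_int k * T + of_nat (Suc n) * T = t" unfolding k by (simp add: algebra_simps)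
    from nat[of "t + of_int k * T" "Suc n"] show ?thesis unfolding eq by simp
  qed
qed

lemma f_shift_nat: "f (t + of_nat n * T) = f t"
  using f_shift[of t "int n"] by simp

lemma period_decomp:
  obtains k :: int and x where "t = x + of_int k * T" "0 \<le> x" "x < T"
proof
  show "t = (t - of_int \<lfloor>t / T\<rfloor> * T) + of_int \<lfloor>t / T\<rfloor> * T" by simp
  then show "0 \<le> t - of_int \<lfloor>t / T\<rfloor> * T" "t - of_int \<lfloor>t / T\<rfloor> * T < T"
    using floor_divide_lower[OF T_pos, of t] floor_divide_upper[OF T_pos, of t]
    by (auto simp: algebra_simps)
qed

lemma f_less_falling:
  assumes "of_int k * T \<le> s" "s < t" "t \<le> \<beta> + of_int k * T"
  shows "f t < f s"
proof -
  have "f (t - of_int k * T) < f (s - of_int k * T)"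
    using assms by (intro monotone_onD[OF f_falls]) auto
  then show ?thesis
    using f_shift[of "t - of_int k * T" k] f_shift[of "s - of_int k * T" k] by simp
qed

lemma f_less_rising:
  assumes "\<beta> + of_int k * T \<le> s" "s < t" "t \<le> T + of_int k * T"
  shows "f s < f t"
proof -
  have "f (s - of_int k * T) < f (t - of_int k * T)"
    using assms by (intro monotone_onD[OF f_rises]) auto
  then show ?thesis
    using f_shift[of "t - of_int k * T" k] f_shift[of "s - of_int k * T" k] by simp
qed

lemma sum_neg: "a + b < 0"
proof (cases "a + b < 0 \<and> a * h \<le> 1")
  case False
  then have "b * h < - exp (a * h - 1)" using stable by auto
  moreover have "a * h \<le> exp (a * h - 1)" using exp_ge_add_one_self[of "a * h - 1"] by simp
  ultimately have "(a + b) * h < 0" by (simp add: algebra_simps)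
  then show ?thesis using h by (simp add: mult_less_0_iff)
qed simp

text \<open>A decreasing solution has its oldest value as window maximum, so without forcing it obeys
  \<open>x' t = a x t + b x (t - h)\<close>. The absence of nonnegative roots of the characteristic function
  of this equation is what the two alternative stability assumptions have in common.\<close>
lemma characteristic_pos:
  assumes "b < 0" "0 \<le> \<mu>"
  shows "0 < \<mu> - a - b * exp (- \<mu> * h)"
proof (cases "a + b < 0 \<and> a * h \<le> 1")
  case True
  show ?thesis
  proof (cases "a \<le> 0")
    case True
    moreover have "b * exp (- \<mu> * h) < 0" using assms by (auto simp: mult_less_0_iff)
    ultimately show ?thesis using assms by linarith
  next
    case False
    have "a * (1 - \<mu> * h) \<le> a * exp (- \<mu> * h)"
      using False exp_ge_add_one_self[of "- \<mu> * h"] by (intro mult_left_mono) auto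
    also have "\<dots> < - b * exp (- \<mu> * h)"
      using sum_neg by (intro mult_strict_right_mono) auto
    finally have "a - \<mu> * (a * h) < - b * exp (- \<mu> * h)" by (simp add: algebra_simps)
    moreover have "\<mu> * (a * h) \<le> \<mu> * 1"
      using True assms by (intro mult_left_mono) auto
    ultimately show ?thesis by simp
  qed
next
  case False
  then have "exp (a * h - 1) < - b * h" using stable by auto
  then have "exp (a * h - 1) * exp (- \<mu> * h) < - b * h * exp (- \<mu> * h)"
    by (intro mult_strict_right_mono) auto
  moreover have "a * h - \<mu> * h \<le> exp (a * h - 1) * exp (- \<mu> * h)"
    using exp_ge_add_one_self[of "a * h - 1 + - \<mu> * h"] by (simp flip: exp_add)
  ultimately have "0 < (\<mu> - a - b * exp (- \<mu> * h)) * h" by (simp add: algebra_simps)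
  then show ?thesis using h by (simp add: zero_less_mult_iff)
qed

text \<open>The equation takes this form while the window maximum stays equal to the value at \<open>r\<close>.
  The solution then moves in the direction in which \<open>f\<close> does, so it can stay below that value
  only where \<open>f\<close> falls.\<close>
lemma dominated_starts_falling:
  fixes y :: "real \<Rightarrow> real"
  assumes "0 < \<delta>" and cont: "continuous_on {r..r + \<delta>} y"
    and deriv: "\<And>s. r < s \<Longrightarrow> s < r + \<delta> \<Longrightarrow>
       (y has_real_derivative a * (y s - y r) + (f s - f r)) (at s)"
    and le: "\<And>s. r \<le> s \<Longrightarrow> s \<le> r + \<delta> \<Longrightarrow> y s \<le> y r"
  obtains k :: int and q where "r = q + of_int k * T" "0 \<le> q" "q < \<beta>"
proof -
  obtain k x where x: "r = x + of_int k * T" "0 \<le> x" "x < T" by (rule period_decomp)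
  have "x < \<beta>"
  proof (rule ccontr)
    assume "\<not> x < \<beta>"
    define t where "t = min (r + \<delta>) (T + of_int k * T)"
    have t: "r < t" "t \<le> r + \<delta>" "t \<le> T + of_int k * T" using x \<open>0 < \<delta>\<close> by (auto simp: t_def)
    have "y r < y t"
    proof (rule above_initial_value[OF \<open>r < t\<close>])
      show "continuous_on {r..t} y" using t by (auto intro: continuous_on_subset[OF cont])
      show "(y has_real_derivative a * (y s - y r) + (f s - f r)) (at s)" if "r < s" "s < t" for s
        using deriv that t by auto
      show "0 < f s - f r" if "r < s" "s < t" for s
        using that t x \<open>\<not> x < \<beta>\<close> f_less_rising[of k r s] by auto
    qed
    then show False using le[of t] t by auto
  qed
  then show ?thesis using x that by blast
qed

lemma falling_phase_unique:
  assumes "r = q + of_int k * T" "0 \<le> q" "q < \<beta>"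
    and "r' = q' + of_int k' * T" "0 \<le> q'" "q' < \<beta>"
    and "f r = f r'"
  shows "q = q'"
proof -
  have "f q = f q'" using assms f_shift by simp
  then show ?thesis
    using f_less_falling[of 0 q q'] f_less_falling[of 0 q' q] assms by (cases q q' rule: linorder_cases) auto
qed

end

locale max_solution = max_equation +
  fixes \<alpha> :: real and u :: "real \<Rightarrow> real"
  assumes solution: "is_solution a b h f \<alpha> u"
begin

abbreviation M :: "real \<Rightarrow> real" where "M \<equiv> window_max h u"

lemmas u_cont = is_solution_continuous[OF solution]
  and u_deriv = is_solution_deriv[OF solution]

lemma u_cont_on: "\<alpha> \<le> s \<Longrightarrow> continuous_on {s..t} u"
  by (auto intro: continuous_on_subset[OF u_cont])

lemma M_ge: "\<alpha> + h \<le> t \<Longrightarrow> t - h \<le> s \<Longrightarrow> s \<le> t \<Longrightarrow> u s \<le> M t"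
  using window_max_ge[OF u_cont] h by auto

lemma M_attained:
  assumes "\<alpha> + h \<le> t"
  obtains r where "t - h \<le> r" "r \<le> t" "M t = u r"
  using window_max_attained[OF u_cont, of t h] assms h by (metis atLeastAtMost_iff le_diff_eq)

lemma peak_iff:
  "\<alpha> + h \<le> t \<Longrightarrow> window_peak h u t \<longleftrightarrow> (\<exists>\<epsilon>>0. \<forall>s\<in>{t - h..t + \<epsilon>}. u s \<le> u t)"
  using window_peak_iff[OF u_cont, of t h] h by auto

section \<open>Peaks\<close>

lemma M_eq_peak_value:
  assumes "\<tau> \<le> t" "t \<le> \<tau> + h" "\<And>s. \<tau> - h \<le> s \<Longrightarrow> s \<le> t \<Longrightarrow> u s \<le> u \<tau>"
  shows "M t = u \<tau>"
  using assms by (intro window_max_eqI) auto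

lemma peak_equation:
  assumes \<tau>: "\<alpha> + h < \<tau>" and peak: "window_peak h u \<tau>"
  shows "f \<tau> = - (a + b) * u \<tau>"
proof -
  obtain \<epsilon> where \<epsilon>: "0 < \<epsilon>" "\<forall>s\<in>{\<tau> - h..\<tau> + \<epsilon>}. u s \<le> u \<tau>"
    using peak \<tau> by (auto simp: peak_iff)
  have "M \<tau> = u \<tau>" using \<epsilon> h by (intro M_eq_peak_value) auto
  moreover have "a * u \<tau> + b * M \<tau> + f \<tau> = 0"
  proof (rule DERIV_local_max[OF u_deriv[OF \<tau>], of "min h \<epsilon>"])
    show "\<forall>s. \<bar>\<tau> - s\<bar> < min h \<epsilon> \<longrightarrow> u s \<le> u \<tau>" by (auto intro!: \<epsilon>(2)[rule_format])
  qed (use \<epsilon> h in auto)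
  ultimately show ?thesis by (simp add: algebra_simps)
qed

lemma deriv_under_peak:
  assumes \<tau>: "\<alpha> + h < \<tau>" and peak: "window_peak h u \<tau>"
    and "\<tau> \<le> t" "t \<le> \<tau> + h" "\<And>s. \<tau> - h \<le> s \<Longrightarrow> s \<le> t \<Longrightarrow> u s \<le> u \<tau>"
  shows "(u has_real_derivative a * (u t - u \<tau>) + (f t - f \<tau>)) (at t)"
proof -
  have eq: "a * u t + b * M t + f t = a * (u t - u \<tau>) + (f t - f \<tau>)"
    using M_eq_peak_value[OF assms(3-5)] peak_equation[OF \<tau> peak] by (simp add: algebra_simps)
  have "\<alpha> + h < t" using assms by simp
  from u_deriv[OF this] show ?thesis unfolding eq .
qed

lemma peak_phase:
  assumes \<tau>: "\<alpha> + h < \<tau>" and peak: "window_peak h u \<tau>"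
  obtains k :: int and q where "\<tau> = q + of_int k * T" "0 \<le> q" "q < \<beta>"
proof -
  obtain \<epsilon> where \<epsilon>: "0 < \<epsilon>" "\<forall>s\<in>{\<tau> - h..\<tau> + \<epsilon>}. u s \<le> u \<tau>"
    using peak \<tau> by (auto simp: peak_iff)
  show ?thesis
  proof (rule dominated_starts_falling[of "min h \<epsilon>" \<tau> u])
    show "continuous_on {\<tau>..\<tau> + min h \<epsilon>} u" using \<tau> h by (intro u_cont_on) auto
    show "(u has_real_derivative a * (u s - u \<tau>) + (f s - f \<tau>)) (at s)"
      if "\<tau> < s" "s < \<tau> + min h \<epsilon>" for s
      using that \<epsilon> by (intro deriv_under_peak[OF \<tau> peak]) auto
  qed (use \<epsilon> h that in auto)
qed

text \<open>After a peak the solution falls as long as \<open>f\<close> does and the peak remains in the window.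
  The restriction to a half-open interval before \<open>t\<close> in the hypothesis is what the continuation
  argument below needs.\<close>
lemma below_peak_step:
  assumes \<tau>: "\<alpha> + h < \<tau>" and peak: "window_peak h u \<tau>"
    and q: "\<tau> = q + of_int k * T" "0 \<le> q"
    and t: "\<tau> < t" "t \<le> \<tau> + h" "t \<le> \<beta> + of_int k * T"
    and le: "\<And>s. \<tau> - h \<le> s \<Longrightarrow> s < t \<Longrightarrow> u s \<le> u \<tau>"
  shows "u t < u \<tau>"
proof (rule below_initial_value[OF \<open>\<tau> < t\<close>])
  show "continuous_on {\<tau>..t} u" using \<tau> h by (intro u_cont_on) auto
  show "(u has_real_derivative a * (u s - u \<tau>) + (f s - f \<tau>)) (at s)" if "\<tau> < s" "s < t" for s
    using that t le by (intro deriv_under_peak[OF \<tau> peak]) auto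
  show "f s - f \<tau> < 0" if "\<tau> < s" "s < t" for s
    using that t q f_less_falling[of k \<tau> s] by auto
qed

lemma below_peak:
  assumes \<tau>: "\<alpha> + h < \<tau>" and peak: "window_peak h u \<tau>"
    and q: "\<tau> = q + of_int k * T" "0 \<le> q"
    and t: "\<tau> < t" "t \<le> \<tau> + h" "t \<le> \<beta> + of_int k * T"
  shows "u t < u \<tau>"
proof (rule ccontr)
  assume "\<not> u t < u \<tau>"
  obtain \<epsilon> where \<epsilon>: "0 < \<epsilon>" "\<forall>s\<in>{\<tau> - h..\<tau> + \<epsilon>}. u s \<le> u \<tau>"
    using peak \<tau> by (auto simp: peak_iff)
  have "\<tau> + \<epsilon> < t"
    using below_peak_step[OF \<tau> peak q t] \<epsilon> \<open>\<not> u t < u \<tau>\<close> by force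
  (* The least element of S is the first return to the peak value. *)
  define S where "S = {\<tau> + \<epsilon>..t} \<inter> u -` {u \<tau>..}"
  have "closed S"
    unfolding S_def using \<tau> \<epsilon> h by (intro continuous_closed_preimage u_cont_on) auto
  then have "compact S"
    unfolding compact_eq_bounded_closed
    by (auto simp: S_def intro: bounded_subset[of "{\<tau> + \<epsilon>..t}"])
  moreover have "t \<in> S" using \<open>\<not> u t < u \<tau>\<close> \<open>\<tau> + \<epsilon> < t\<close> by (auto simp: S_def)
  ultimately obtain t1 where t1: "t1 \<in> S" "\<And>s. s \<in> S \<Longrightarrow> t1 \<le> s"
    using compact_attains_inf[of S] by blast
  have "u s \<le> u \<tau>" if "\<tau> - h \<le> s" "s < t1" for s
  proof (cases "s \<le> \<tau> + \<epsilon>")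
    case False
    have "s \<notin> S" using t1(2)[of s] that by auto
    then show ?thesis using False t1(1) that by (auto simp: S_def)
  qed (use \<epsilon> that in auto)
  then have "u t1 < u \<tau>"
    using t1(1) t \<epsilon> by (intro below_peak_step[OF \<tau> peak q]) (auto simp: S_def)
  then show False using t1 by (auto simp: S_def)
qed

text \<open>A later peak cannot occur while \<open>u\<close> is below the current peak value and the current peak is
  in the window. So either the window has passed, or \<open>f\<close> has stopped falling; then the next
  falling phase, the only place for a peak, starts only after a whole rising phase.\<close>
lemma peak_gap:
  assumes \<tau>: "\<alpha> + h < \<tau>" and peak: "window_peak h u \<tau>"
    and peak': "window_peak h u \<tau>'" and less: "\<tau> < \<tau>'"
  shows "min h (T - \<beta>) \<le> \<tau>' - \<tau>"
proof (rule ccontr)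
  assume neg: "\<not> min h (T - \<beta>) \<le> \<tau>' - \<tau>"
  obtain k q where q: "\<tau> = q + of_int k * T" "0 \<le> q" "q < \<beta>"
    using peak_phase[OF \<tau> peak] by blast
  obtain k' q' where q': "\<tau>' = q' + of_int k' * T" "0 \<le> q'" "q' < \<beta>"
    using peak_phase[of \<tau>'] peak' \<tau> less by (metis order.strict_trans)
  have "\<not> \<tau>' \<le> \<beta> + of_int k * T"
  proof
    assume "\<tau>' \<le> \<beta> + of_int k * T"
    then have "u \<tau>' < u \<tau>" using neg less by (intro below_peak[OF \<tau> peak q(1,2)]) auto
    moreover have "u \<tau> \<le> u \<tau>'" using peak' neg \<tau> less h by (auto simp: peak_iff)
    ultimately show False by simp
  qed
  then have "k < k'" using q q' T_pos 
    by (smt (verit, best) mult_right_mono of_int_le_iff)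
  then have "(of_int k + 1) * T \<le> of_int k' * T"
    using T_pos by (intro mult_right_mono) linarith+
  then show False using neg q q' by (simp add: algebra_simps)
qed

section \<open>The return map\<close>

lemma start_point_of_phase:
  assumes "0 \<le> q" "q \<le> \<beta>"
  shows "start_point a b f \<beta> (f_tilde a b f q) = q"
  unfolding start_point_def
proof (rule the_equality)
  fix x assume x: "x \<in> {0..\<beta>} \<and> f_tilde a b f x = f_tilde a b f q"
  then have "f x = f q" using sum_neg by (simp add: f_tilde_def)
  then show "x = q"
    using f_less_falling[of 0 q x] f_less_falling[of 0 x q] assms x
    by (cases q x rule: linorder_cases) auto
qed (use assms in auto)

lemma peak_value:
  assumes \<tau>: "\<alpha> + h < \<tau>" and peak: "window_peak h u \<tau>"
    and q: "\<tau> = q + of_int k * T"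
  shows "u \<tau> = f_tilde a b f q"
  using peak_equation[OF \<tau> peak] sum_neg f_shift[of q k] q
  by (simp add: f_tilde_def field_simps)

text \<open>A peak makes the earlier history irrelevant: replacing it by the constant peak value
  changes no later window maximum. The changed function is a solution on the half line that
  starts at the phase \<open>q\<close> of the peak, hence the constant-history solution there.\<close>
lemma const_sol_after_peak:
  assumes \<tau>: "\<alpha> + h < \<tau>" and peak: "window_peak h u \<tau>"
    and q: "\<tau> = q + of_int k * T" "0 \<le> q" "q < \<beta>" and "q - h \<le> s"
  shows "const_sol a b h f \<beta> (u \<tau>) s = u (max s q + of_int k * T)"
proof -
  (* The maximum with q freezes the history at the peak value. *)
  define v where "v s = u (max s q + of_int k * T)" for s
  have start: "start_point a b f \<beta> (u \<tau>) = q"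
    using start_point_of_phase[of q] q(2,3) peak_value[OF \<tau> peak q(1)] by simp
  have history: "u s \<le> u \<tau>" if "\<tau> - h \<le> s" "s \<le> \<tau>" for s
    using that peak \<tau> by (auto simp: peak_iff)
  have M_v: "window_max h v t = M (t + of_int k * T)" if "q \<le> t" for t
  proof -
    define A where "A = max (t - h) q + of_int k * T"
    have "A \<le> t + of_int k * T" "\<tau> \<le> A" using that h q by (auto simp: A_def)
    then obtain r where r: "r \<in> {A..t + of_int k * T}"
        "\<And>s. s \<in> {A..t + of_int k * T} \<Longrightarrow> u s \<le> u r"
      using continuous_attains_sup[of "{A..t + of_int k * T}" u] u_cont_on[of A "t + of_int k * T"]
        \<tau> h by auto
    (* Values older than A lie in the history, which the window reaches only if A is the peak itself. *)
    have old: "u s \<le> u r" if "t + of_int k * T - h \<le> s" "s < A" for s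
    proof -
      have "A = \<tau>" using that by (auto simp: A_def q max_def split: if_splits)
      then show ?thesis
        using history[of s] r(2)[of \<tau>] that \<open>q \<le> t\<close> q by auto
    qed
    have "max (r - of_int k * T) q = r - of_int k * T" using r(1) by (auto simp: A_def)
    then have v_r: "v (r - of_int k * T) = u r" by (simp add: v_def)
    have "M (t + of_int k * T) = u r"
    proof (rule window_max_eqI)
      show "r \<in> {t + of_int k * T - h..t + of_int k * T}" using r by (auto simp: A_def)
      show "u s \<le> u r" if "s \<in> {t + of_int k * T - h..t + of_int k * T}" for s
        using that r(2)[of s] old[of s] by (cases "s < A") auto
    qed
    moreover have "window_max h v t = v (r - of_int k * T)"
    proof (rule window_max_eqI)
      show "r - of_int k * T \<in> {t - h..t}" using r by (auto simp: A_def)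
      have "v s \<le> u r" if "s \<in> {t - h..t}" for s
        unfolding v_def using that \<open>q \<le> t\<close> by (intro r(2)) (auto simp: A_def)
      then show "v s \<le> v (r - of_int k * T)" if "s \<in> {t - h..t}" for s
        using that v_r by simp
    qed
    ultimately show ?thesis by (simp add: v_r)
  qed
  have v_sol: "is_solution a b h f (q - h) v"
    unfolding is_solution_def
  proof (intro conjI allI impI)
    show "continuous_on {q - h..} v"
      unfolding v_def using \<tau> q h
      by (intro continuous_on_compose2[OF u_cont] continuous_intros) auto
    fix t assume "q - h + h \<le> t"
    then have t: "q \<le> t" by simp
    have "\<alpha> + h < t + of_int k * T" using t \<tau> q by simp
    from DERIV_shift[THEN iffD1, OF u_deriv[OF this]]
    have "((\<lambda>s. u (s + of_int k * T)) has_real_derivative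
        a * v t + b * window_max h v t + f t) (at t within {q..})"
      using t by (auto simp: v_def M_v f_shift max_def intro: has_field_derivative_at_within)
    then have "(v has_real_derivative a * v t + b * window_max h v t + f t) (at t within {q..})"
    proof (rule has_field_derivative_transform_within[where d = 1])
      show "u (s + of_int k * T) = v s" if "s \<in> {q..}" for s
        using that by (simp add: v_def max_def)
    qed (use t in simp_all)
    then show "(v has_real_derivative a * v t + b * (SUP s\<in>{t - h..t}. v s) + f t)
        (at t within {q - h + h..})"
      by (simp add: window_max_def)
  qed
  have v_const: "v s = u \<tau>" if "s \<le> q" for s
    using that q by (simp add: v_def)
  define w where "w = const_sol a b h f \<beta> (u \<tau>)"
  have "is_solution a b h f (q - h) v \<and> (\<forall>s\<in>{q - h..q}. v s = u \<tau>)"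
    using v_sol v_const by simp
  then have w: "is_solution a b h f (q - h) w \<and> (\<forall>s\<in>{q - h..q}. w s = u \<tau>)"
    unfolding w_def const_sol_def start Let_def
    by (rule someI[of "\<lambda>w. is_solution a b h f (q - h) w \<and> (\<forall>s\<in>{q - h..q}. w s = u \<tau>)"])
  have "w s = v s"
  proof (rule solution_unique[of a b h f "q - h" w v])
    show "w x = v x" if "x \<in> {q - h..q - h + h}" for x
      using that w v_const[of x] by simp
  qed (use w v_sol h \<open>q - h \<le> s\<close> in \<open>blast+\<close>)
  then show ?thesis by (simp add: w_def v_def)
qed

text \<open>A window of a later time that reaches back before \<open>\<tau>\<close> contains \<open>\<tau>\<close> itself, whose value
  bounds both the history of \<open>u\<close> and the constant one. Hence \<open>u\<close> and the constant-history solution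
  have corresponding peaks.\<close>
lemma return_map_next_peak:
  assumes \<tau>: "\<alpha> + h < \<tau>" and peak: "window_peak h u \<tau>"
    and less: "\<tau> < \<tau>'" and peak': "window_peak h u \<tau>'"
    and least: "\<And>t. \<tau> < t \<Longrightarrow> window_peak h u t \<Longrightarrow> \<tau>' \<le> t"
  shows "return_map a b h f \<beta> (u \<tau>) = u \<tau>'"
proof -
  obtain k q where q: "\<tau> = q + of_int k * T" "0 \<le> q" "q < \<beta>"
    using peak_phase[OF \<tau> peak] by blast
  have start: "start_point a b f \<beta> (u \<tau>) = q"
    using start_point_of_phase[of q] q(2,3) peak_value[OF \<tau> peak q(1)] by simp
  define w where "w = const_sol a b h f \<beta> (u \<tau>)"
  note w = const_sol_after_peak[OF \<tau> peak q, folded w_def]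
  have w_cont: "continuous_on {q - h..} w"
  proof -
    have "continuous_on {q - h..} (\<lambda>s. u (max s q + of_int k * T))"
      using \<tau> q h by (intro continuous_on_compose2[OF u_cont] continuous_intros) auto
    then show ?thesis by (rule continuous_on_eq) (simp add: w)
  qed
  have history: "u s \<le> u \<tau>" if "\<tau> - h \<le> s" "s \<le> \<tau>" for s
    using that peak \<tau> by (auto simp: peak_iff)
  have same_peaks: "window_peak h w \<nu> \<longleftrightarrow> window_peak h u (\<nu> + of_int k * T)" if \<nu>: "q < \<nu>" for \<nu>
  proof -
    have "(\<forall>s\<in>{\<nu> - h..\<nu> + \<epsilon>}. w s \<le> w \<nu>) \<longleftrightarrow>
        (\<forall>s\<in>{\<nu> + of_int k * T - h..\<nu> + of_int k * T + \<epsilon>}. u s \<le> u (\<nu> + of_int k * T))"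
      (is "?W \<longleftrightarrow> ?U") if \<epsilon>: "0 < \<epsilon>" for \<epsilon>
    proof
      assume W: ?W
      show ?U
      proof
        fix s assume s: "s \<in> {\<nu> + of_int k * T - h..\<nu> + of_int k * T + \<epsilon>}"
        have "u (max (s - of_int k * T) q + of_int k * T) \<le> u (\<nu> + of_int k * T)"
          using W[rule_format, of "s - of_int k * T"] s w[of "s - of_int k * T"] w[of \<nu>] \<nu> h
          by (auto simp: max_def)
        moreover have "u s \<le> u (max (s - of_int k * T) q + of_int k * T)"
          using history[of s] s \<nu> q by (auto simp: max_def)
        ultimately show "u s \<le> u (\<nu> + of_int k * T)" by simp
      qed
    next
      assume U: ?U
      show ?W
      proof
        fix s assume s: "s \<in> {\<nu> - h..\<nu> + \<epsilon>}"
        then have "u (max s q + of_int k * T) \<le> u (\<nu> + of_int k * T)"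
          using \<nu> \<epsilon> h by (intro U[rule_format]) auto
        then show "w s \<le> w \<nu>" using w[of s] w[of \<nu>] s \<nu> h by auto
      qed
    qed
    moreover have "window_peak h w \<nu> \<longleftrightarrow> (\<exists>\<epsilon>>0. \<forall>s\<in>{\<nu> - h..\<nu> + \<epsilon>}. w s \<le> w \<nu>)"
      using window_peak_iff[OF w_cont, of \<nu> h] \<nu> h by auto
    moreover have "\<alpha> + h \<le> \<nu> + of_int k * T" using \<nu> q \<tau> by simp
    ultimately show ?thesis by (auto simp: peak_iff)
  qed
  have "first_peak a b h f \<beta> (u \<tau>) = \<tau>' - of_int k * T"
    unfolding first_peak_def start w_def[symmetric]
  proof (rule Least_equality)
    show "q < \<tau>' - of_int k * T \<and> window_peak h w (\<tau>' - of_int k * T)"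
      using same_peaks[of "\<tau>' - of_int k * T"] peak' less q by auto
    show "\<tau>' - of_int k * T \<le> \<nu>" if "q < \<nu> \<and> window_peak h w \<nu>" for \<nu>
      using that same_peaks[of \<nu>] least[of "\<nu> + of_int k * T"] q by auto
  qed
  then show ?thesis
    using w[of "\<tau>' - of_int k * T"] less q h by (simp add: return_map_def w_def)
qed

section \<open>The solution cannot stay below its window maximum\<close>

text \<open>The window maximum could grow only by a new value, which would then be equal to the window
  maximum at its own time.\<close>
lemma window_max_antitone:
  assumes t0: "\<alpha> + h \<le> t0" and below: "\<And>t. t0 < t \<Longrightarrow> u t < M t"
    and "t0 < s" "s \<le> t"
  shows "M t \<le> M s"
proof -
  obtain r where r: "r \<in> {s - h..t}" "\<And>x. x \<in> {s - h..t} \<Longrightarrow> u x \<le> u r"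
    using continuous_attains_sup[of "{s - h..t}" u] u_cont_on[of "s - h" t] assms h by auto
  have "r \<le> s"
  proof (rule ccontr)
    assume "\<not> r \<le> s"
    then have "M r = u r" using r h by (intro window_max_eqI) auto
    then show False using below[of r] \<open>\<not> r \<le> s\<close> assms by simp
  qed
  then have "u r \<le> M s" using r assms by (intro M_ge) auto
  moreover obtain x where "t - h \<le> x" "x \<le> t" "M t = u x"
    using M_attained[of t] assms by auto
  ultimately show ?thesis using r(2)[of x] assms by auto
qed

text \<open>Once the window maximum is negative, so is \<open>u\<close>, and it suffices to show \<open>u' > 0\<close>: then \<open>u\<close>
  increases and is its own window maximum. For \<open>b \<ge> 0\<close> this is immediate from \<open>u < M\<close>. For
  \<open>b < 0\<close>, a bound \<open>u' \<ge> \<mu> u\<close> with \<open>\<mu> \<ge> 0\<close> improves to one with rate \<open>a + b exp (- \<mu> h)\<close>, since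
  it compares the value at which \<open>M\<close> is attained with the present one. The new rate is smaller by
  at least the minimum of the characteristic function, so finitely many improvements make it
  negative.\<close>
lemma window_max_nonneg_of_below:
  assumes t0: "\<alpha> + h \<le> t0" and below: "\<And>t. t0 < t \<Longrightarrow> u t < M t"
    and "t0 < t1"
  shows "0 \<le> M t1"
proof (rule ccontr)
  assume "\<not> 0 \<le> M t1"
  define rhs where "rhs t = a * u t + b * M t + f t" for t
  have deriv: "(u has_real_derivative rhs t) (at t)" if "t1 \<le> t" for t
    unfolding rhs_def using u_deriv that assms by simp
  have M_neg: "M t < 0" and u_neg: "u t < 0" if "t1 \<le> t" for t
    using window_max_antitone[OF t0 below \<open>t0 < t1\<close> that] below[of t] that
      \<open>\<not> 0 \<le> M t1\<close> \<open>t0 < t1\<close> by simp_all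
  have not_increasing: False if A: "t1 \<le> A" and pos: "\<And>t. A \<le> t \<Longrightarrow> 0 < rhs t" for A
  proof -
    obtain r where r: "A \<le> r" "r \<le> A + h" "M (A + h) = u r"
      using M_attained[of "A + h"] A assms h by auto
    have "u r \<le> u (A + h)"
    proof (rule DERIV_nonneg_imp_nondecreasing[OF r(2)])
      fix x assume "r \<le> x" "x \<le> A + h"
      then show "\<exists>y. (u has_real_derivative y) (at x) \<and> 0 \<le> y"
        using deriv[of x] pos[of x] r A by (intro exI[of _ "rhs x"]) auto
    qed
    then show False using below[of "A + h"] r A assms h by simp
  qed
  have improve: "(a + b * exp (- \<mu> * h)) * u t \<le> rhs t"
    if "b < 0" "0 \<le> \<mu>" and A: "t1 \<le> A" and bound: "\<And>t. A \<le> t \<Longrightarrow> \<mu> * u t \<le> rhs t"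
      and t: "A + h \<le> t" for \<mu> A t
  proof -
    obtain r where r: "t - h \<le> r" "r \<le> t" "M t = u r"
      using M_attained[of t] A t assms h by auto
    have "exp (- \<mu> * r) * u r \<le> exp (- \<mu> * t) * u t"
    proof (rule DERIV_nonneg_imp_nondecreasing[OF r(2)])
      fix x assume x: "r \<le> x" "x \<le> t"
      then have "t1 \<le> x" "A \<le> x" using r A t h by auto
      have "((\<lambda>x. exp (- \<mu> * x) * u x) has_real_derivative exp (- \<mu> * x) * (rhs x - \<mu> * u x)) (at x)"
        by (auto intro!: derivative_eq_intros deriv \<open>t1 \<le> x\<close> simp: algebra_simps)
      then show "\<exists>y. ((\<lambda>x. exp (- \<mu> * x) * u x) has_real_derivative y) (at x) \<and> 0 \<le> y"
        using bound[OF \<open>A \<le> x\<close>]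
        by (intro exI[of _ "exp (- \<mu> * x) * (rhs x - \<mu> * u x)"]) auto
    qed
    then have "exp (\<mu> * r) * (exp (- \<mu> * r) * u r) \<le> exp (\<mu> * r) * (exp (- \<mu> * t) * u t)"
      by (intro mult_left_mono) auto
    moreover have "exp (\<mu> * r) * (exp (- \<mu> * r) * u r) = u r"
      by (simp flip: mult.assoc exp_add)
    moreover have "exp (\<mu> * r) * (exp (- \<mu> * t) * u t) = exp (\<mu> * (r - t)) * u t"
      by (simp add: right_diff_distrib flip: mult.assoc exp_add)
    ultimately have "M t \<le> exp (\<mu> * (r - t)) * u t" unfolding r(3) by (simp only:)
    also have "\<dots> \<le> exp (- \<mu> * h) * u t"
    proof (rule mult_right_mono_neg)
      have "\<mu> * (- h) \<le> \<mu> * (r - t)" using r \<open>0 \<le> \<mu>\<close> by (intro mult_left_mono) auto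
      then show "exp (- \<mu> * h) \<le> exp (\<mu> * (r - t))" by simp
    qed (use u_neg[of t] A t h in auto)
    finally have "b * (exp (- \<mu> * h) * u t) \<le> b * M t"
      using \<open>b < 0\<close> by (intro mult_left_mono_neg) auto
    then show ?thesis unfolding rhs_def using f_nonneg[of t] by (simp add: algebra_simps)
  qed
  show False
  proof (cases "b < 0")
    case False
    show False
    proof (rule not_increasing[of t1])
      fix t assume "t1 \<le> t"
      then have "u t < M t" using below \<open>t0 < t1\<close> by simp
      then have "b * u t \<le> b * M t" using False by (intro mult_left_mono) auto
      moreover have "0 < (a + b) * u t"
        using sum_neg u_neg[OF \<open>t1 \<le> t\<close>] by (simp add: mult_neg_neg)
      ultimately show "0 < rhs t"
        unfolding rhs_def using f_nonneg[of t] by (simp add: algebra_simps)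
    qed simp
  next
    case True
    (* The starting rate: below a negative maximum the delayed term only helps. *)
    define \<Lambda> where "\<Lambda> = max a 0"
    have "continuous_on {0..\<Lambda>} (\<lambda>\<mu>. \<mu> - a - b * exp (- \<mu> * h))"
      by (intro continuous_intros)
    then obtain m where m: "m \<in> {0..\<Lambda>}"
        "\<And>\<mu>. \<mu> \<in> {0..\<Lambda>} \<Longrightarrow> m - a - b * exp (- m * h) \<le> \<mu> - a - b * exp (- \<mu> * h)"
      using continuous_attains_inf[of "{0..\<Lambda>}" "\<lambda>\<mu>. \<mu> - a - b * exp (- \<mu> * h)"]
      by (auto simp: \<Lambda>_def)
    define \<delta> where "\<delta> = m - a - b * exp (- m * h)"
    have "0 < \<delta>" using characteristic_pos[OF True, of m] m(1) by (simp add: \<delta>_def)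
    have faster: "(\<mu> - \<delta>) * u t \<le> rhs t"
      if "0 \<le> \<mu>" "\<mu> \<le> \<Lambda>" "t1 \<le> A" "\<And>t. A \<le> t \<Longrightarrow> \<mu> * u t \<le> rhs t" "A + h \<le> t" for \<mu> A t
    proof -
      have "(\<mu> - \<delta>) * u t \<le> (a + b * exp (- \<mu> * h)) * u t"
        using m(2)[of \<mu>] that u_neg[of t] h by (intro mult_right_mono_neg) (auto simp: \<delta>_def)
      also have "\<dots> \<le> rhs t" using improve[OF True] that by blast
      finally show ?thesis .
    qed
    have rates: "\<exists>A\<ge>t1. \<forall>t\<ge>A. max (\<Lambda> - of_nat n * \<delta>) 0 * u t \<le> rhs t" for n
    proof (induction n)
      case 0
      have "\<Lambda> * u t \<le> rhs t" if "t1 \<le> t" for t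
      proof -
        have "\<Lambda> * u t \<le> a * u t"
          using u_neg[OF that] by (intro mult_right_mono_neg) (auto simp: \<Lambda>_def)
        moreover have "0 \<le> b * M t" using True M_neg[OF that] by (simp add: mult_nonpos_nonpos)
        ultimately show ?thesis unfolding rhs_def using f_nonneg[of t] by simp
      qed
      then show ?case by (intro exI[of _ t1]) (auto simp: \<Lambda>_def)
    next
      case (Suc n)
      define \<mu> where "\<mu> = max (\<Lambda> - of_nat n * \<delta>) 0"
      have \<mu>: "0 \<le> \<mu>" "\<mu> \<le> \<Lambda>" "\<mu> - \<delta> \<le> max (\<Lambda> - of_nat (Suc n) * \<delta>) 0"
        using \<open>0 < \<delta>\<close> by (auto simp: \<mu>_def \<Lambda>_def algebra_simps)
      obtain A where A: "t1 \<le> A" "\<And>t. A \<le> t \<Longrightarrow> \<mu> * u t \<le> rhs t"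
        using Suc by (auto simp: \<mu>_def)
      have "max (\<Lambda> - of_nat (Suc n) * \<delta>) 0 * u t \<le> rhs t" if "A + h \<le> t" for t
      proof -
        have "max (\<Lambda> - of_nat (Suc n) * \<delta>) 0 * u t \<le> (\<mu> - \<delta>) * u t"
          using \<mu>(3) u_neg[of t] A that h by (intro mult_right_mono_neg) auto
        also have "\<dots> \<le> rhs t" using faster[OF \<mu>(1,2) A that] .
        finally show ?thesis .
      qed
      then show ?case using A h by (intro exI[of _ "A + h"]) auto
    qed
    obtain n where "\<Lambda> / \<delta> < of_nat n" using reals_Archimedean2 by blast
    then have "max (\<Lambda> - of_nat n * \<delta>) 0 = 0" using \<open>0 < \<delta>\<close> by (simp add: field_simps)
    then obtain A where A: "t1 \<le> A" "\<And>t. A \<le> t \<Longrightarrow> 0 * u t \<le> rhs t"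
      using rates[of n] by auto
    show False
    proof (rule not_increasing[of "A + h"])
      fix t assume t: "A + h \<le> t"
      have "(0 - \<delta>) * u t \<le> rhs t"
        using A t by (intro faster) (auto simp: \<Lambda>_def)
      moreover have "0 < (0 - \<delta>) * u t"
        using \<open>0 < \<delta>\<close> u_neg[of t] t A h by (intro mult_neg_neg) auto
      ultimately show "0 < rhs t" by linarith
    qed (use A h in simp)
  qed
qed

text \<open>When the window maximum decreases to \<open>L\<close>, the translates of \<open>u\<close> by periods accumulate at
  solutions of \<open>y' = a y + b L + f\<close> that stay below \<open>L\<close> and touch it in the given window. Once
  the positions of the maximum in the window converge along a subsequence, the variation of
  constants formula makes the translates themselves converge. Touching \<open>L\<close> from below forces the stated level and phase of \<open>f\<close>.\<close>
lemma limit_touches_in_window: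
  assumes t0: "\<alpha> + h \<le> t0" and below: "\<And>t. t0 < t \<Longrightarrow> u t < M t"
    and L: "(M \<longlongrightarrow> L) at_top" and c: "t0 + 2 * h < c"
  obtains r k q where "c \<le> r" "r \<le> c + h" "f r = - (a + b) * L"
    "r = q + of_int k * T" "0 \<le> q" "q < \<beta>"
proof -
  define S where "S = {c - h..c + 2 * h}"
  have M_lim: "(\<lambda>j. M (s + of_nat (\<sigma> j) * T)) \<longlonglongrightarrow> L" if "strict_mono \<sigma>" for s and \<sigma> :: "nat \<Rightarrow> nat"
  proof -
    have "filterlim (\<lambda>j. s + of_nat j * T) at_top sequentially"
      using T_pos by real_asymp
    then have "(\<lambda>j. M (s + of_nat j * T)) \<longlonglongrightarrow> L"
      by (rule filterlim_compose[OF L])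
    from LIMSEQ_subseq_LIMSEQ[OF this that] show ?thesis by (simp add: o_def)
  qed
  have late: "t0 + h < s + of_nat j * T" if "s \<in> S" for s and j :: nat
  proof -
    have "0 \<le> of_nat j * T" using T_pos by simp
    then show ?thesis using that c by (auto simp: S_def)
  qed
  have "\<exists>r\<in>{c..c + h}. u (r + of_nat j * T) = M (c + h + of_nat j * T)" for j :: nat
  proof -
    obtain x where "c + of_nat j * T \<le> x" "x \<le> c + h + of_nat j * T" "M (c + h + of_nat j * T) = u x"
      using M_attained[of "c + h + of_nat j * T"] late[of "c + h" j] t0 h by (auto simp: S_def)
    then show ?thesis by (intro bexI[of _ "x - of_nat j * T"]) auto
  qed
  then obtain r where r: "\<And>j. r j \<in> {c..c + h}"
      "\<And>j. u (r j + of_nat j * T) = M (c + h + of_nat j * T)"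
    by metis
  obtain r0 \<sigma> where r0: "r0 \<in> {c..c + h}" and \<sigma>: "strict_mono \<sigma>" and r_lim: "(r \<circ> \<sigma>) \<longlonglongrightarrow> r0"
    using r(1) compact_Icc[of c "c + h"] unfolding compact_def by metis
  define \<rho> where "\<rho> j = r (\<sigma> j)" for j
  define w where "w j s = u (s + of_nat (\<sigma> j) * T)" for j s
  define m where "m j s = M (s + of_nat (\<sigma> j) * T)" for j s
  have \<rho>: "\<rho> j \<in> S" "w j (\<rho> j) = m j (c + h)" for j
    using r[of "\<sigma> j"] h by (auto simp: \<rho>_def w_def m_def S_def)
  have "\<rho> = r \<circ> \<sigma>" by (simp add: \<rho>_def fun_eq_iff)
  then have \<rho>_lim: "\<rho> \<longlonglongrightarrow> r0" using r_lim by simp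
  have m_lim: "(\<lambda>j. m j s) \<longlonglongrightarrow> L" for s unfolding m_def by (rule M_lim[OF \<sigma>])
  have m_ge: "L \<le> m j s" if "s \<in> S" for j s
  proof (rule tendsto_upperbound[OF L])
    show "eventually (\<lambda>t. M t \<le> m j s) at_top"
      unfolding m_def eventually_at_top_linorder
      using late[OF that, of "\<sigma> j"] h
      by (intro exI[of _ "s + of_nat (\<sigma> j) * T"]) (auto intro!: window_max_antitone[OF t0 below])
  qed simp
  have m_le: "m j s \<le> m j (c - h)" if "s \<in> S" for j s
    unfolding m_def using that late[of "c - h" "\<sigma> j"] h
    by (intro window_max_antitone[OF t0 below]) (auto simp: S_def)
  have w_le: "w j s \<le> m j s" if "s \<in> S" for j s
    unfolding w_def m_def using late[OF that, of "\<sigma> j"] t0 h by (intro M_ge) auto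
  have w_deriv: "(w j has_real_derivative a * w j s + b * m j s + f s) (at s)" if "s \<in> S" for j s
  proof -
    have "\<alpha> + h < s + of_nat (\<sigma> j) * T" using late[OF that, of "\<sigma> j"] t0 h by simp
    note DERIV_shift[THEN iffD1, OF u_deriv[OF this]]
    moreover have "w j = (\<lambda>s. u (s + of_nat (\<sigma> j) * T))" by (simp add: w_def fun_eq_iff)
    ultimately show ?thesis by (simp add: m_def f_shift_nat)
  qed

  have "continuous_on S (\<lambda>s. exp (- a * s) * (b * L + f s))"
    by (intro continuous_intros continuous_on_subset[OF f_cont]) auto
  then obtain G where G: "\<And>s. s \<in> S \<Longrightarrow>
      (G has_real_derivative exp (- a * s) * (b * L + f s)) (at s within S)"
    using antiderivative_continuous[of "c - h" "c + 2 * h" "\<lambda>s. exp (- a * s) * (b * L + f s)"]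
    unfolding S_def has_real_derivative_iff_has_vector_derivative by metis
  have "continuous_on S G"
    using G by (intro DERIV_continuous_on)
  (* Variation of constants: E is almost constant, its derivative being a multiple of m - L. *)
  define E where "E j s = exp (- a * s) * w j s - G s" for j s
  have E_deriv: "(E j has_real_derivative exp (- a * s) * b * (m j s - L)) (at s within S)"
    if "s \<in> S" for j s
    unfolding E_def
    by (auto intro!: derivative_eq_intros G that has_field_derivative_at_within[OF w_deriv]
        simp: algebra_simps)
  have "continuous_on S (\<lambda>s. \<bar>exp (- a * s) * b\<bar>)"
    by (intro continuous_intros)
  then have "\<exists>x0\<in>S. \<forall>s\<in>S. \<bar>exp (- a * s) * b\<bar> \<le> \<bar>exp (- a * x0) * b\<bar>"
    using h by (intro continuous_attains_sup) (auto simp: S_def)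
  then obtain x0 where x0: "\<And>s. s \<in> S \<Longrightarrow> \<bar>exp (- a * s) * b\<bar> \<le> \<bar>exp (- a * x0) * b\<bar>"
    by blast
  define C where "C = \<bar>exp (- a * x0) * b\<bar>"
  have E_close: "\<bar>E j s - E j (\<rho> j)\<bar> \<le> C * (m j (c - h) - L) * (3 * h)" if "s \<in> S" for j s
  proof -
    have "norm (E j s - E j (\<rho> j)) \<le> C * (m j (c - h) - L) * norm (s - \<rho> j)"
    proof (rule field_differentiable_bound[of S])
      show "norm (exp (- a * x) * b * (m j x - L)) \<le> C * (m j (c - h) - L)" if "x \<in> S" for x
        using x0[OF that] m_ge[OF that, of j] m_le[OF that, of j]
        unfolding C_def real_norm_def abs_mult[of _ "m j x - L"] by (intro mult_mono) auto
    qed (use E_deriv that \<rho> in \<open>auto simp: S_def\<close>)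
    also have "\<dots> \<le> C * (m j (c - h) - L) * (3 * h)"
      using that \<rho>(1)[of j] m_ge[of "c - h" j] h
      by (intro mult_left_mono) (auto simp: S_def C_def)
    finally show ?thesis by simp
  qed
  define E0 where "E0 = exp (- a * r0) * L - G r0"
  have "(\<lambda>j. G (\<rho> j)) \<longlonglongrightarrow> G r0"
    using \<open>continuous_on S G\<close> \<rho>_lim \<rho>(1) r0 h
    by (intro continuous_on_tendsto_compose[of S G]) (auto simp: S_def)
  then have E_base: "(\<lambda>j. E j (\<rho> j)) \<longlonglongrightarrow> E0"
    unfolding E_def E0_def \<rho>(2) by (intro tendsto_intros m_lim \<rho>_lim)
  define y where "y s = exp (a * s) * (E0 + G s)" for s
  have w_lim: "(\<lambda>j. w j s) \<longlonglongrightarrow> y s" if "s \<in> S" for s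
  proof -
    have "(\<lambda>j. C * (m j (c - h) - L) * (3 * h)) \<longlonglongrightarrow> C * (L - L) * (3 * h)"
      by (intro tendsto_intros m_lim)
    then have bound_lim: "(\<lambda>j. C * (m j (c - h) - L) * (3 * h)) \<longlonglongrightarrow> 0" by simp
    have "(\<lambda>j. E j s - E j (\<rho> j)) \<longlonglongrightarrow> 0"
      by (rule Lim_null_comparison[OF _ bound_lim]) (simp add: E_close[OF that])
    from tendsto_add[OF this E_base] have "(\<lambda>j. E j s) \<longlonglongrightarrow> E0" by simp
    then have "(\<lambda>j. exp (a * s) * (E j s + G s)) \<longlonglongrightarrow> y s"
      unfolding y_def by (intro tendsto_intros)
    moreover have "exp (a * s) * (E j s + G s) = w j s" for j
      by (simp add: E_def mult.assoc[symmetric] flip: exp_add)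
    ultimately show ?thesis by simp
  qed
  have y_le: "y s \<le> L" if "s \<in> S" for s
    using LIMSEQ_le[OF w_lim[OF that] m_lim[of s]] w_le[OF that] by blast
  have y_r0: "y r0 = L" by (simp add: y_def E0_def mult.assoc[symmetric] flip: exp_add)
  have y_deriv: "(y has_real_derivative a * y s + b * L + f s) (at s)"
    if "c - h < s" "s < c + 2 * h" for s
  proof -
    have "at s within S = at s" using that by (intro at_within_interior) (auto simp: S_def)
    then have "(G has_real_derivative exp (- a * s) * (b * L + f s)) (at s)"
      using G[of s] that by (simp add: S_def)
    then have "(y has_real_derivative a * exp (a * s) * (E0 + G s)
        + exp (a * s) * (exp (- a * s) * (b * L + f s))) (at s)"
      unfolding y_def by (auto intro!: derivative_eq_intros simp: algebra_simps)
    moreover have "exp (a * s) * (exp (- a * s) * (b * L + f s)) = b * L + f s"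
      by (simp add: mult.assoc[symmetric] flip: exp_add)
    ultimately show ?thesis by (simp add: y_def algebra_simps)
  qed
  have "a * y r0 + b * L + f r0 = 0"
  proof (rule DERIV_local_max[OF y_deriv, of r0 h])
    show "\<forall>s. \<bar>r0 - s\<bar> < h \<longrightarrow> y s \<le> y r0"
      unfolding y_r0 using r0 by (auto intro!: y_le simp: S_def abs_less_iff)
  qed (use r0 h in auto)
  then have f_r0: "f r0 = - (a + b) * L" by (simp add: y_r0 algebra_simps)
  obtain k q where "r0 = q + of_int k * T" "0 \<le> q" "q < \<beta>"
  proof (rule dominated_starts_falling[of "h / 2" r0 y])
    show "continuous_on {r0..r0 + h / 2} y"
      using r0 h by (intro continuous_at_imp_continuous_on ballI DERIV_isCont[OF y_deriv]) auto
    show "(y has_real_derivative a * (y s - y r0) + (f s - f r0)) (at s)"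
      if "r0 < s" "s < r0 + h / 2" for s
    proof -
      have eq: "a * y s + b * L + f s = a * (y s - y r0) + (f s - f r0)"
        by (simp add: y_r0 f_r0 algebra_simps)
      have "c - h < s" "s < c + 2 * h" using that r0 h by auto
      from y_deriv[OF this] show ?thesis unfolding eq .
    qed
    show "y s \<le> y r0" if "r0 \<le> s" "s \<le> r0 + h / 2" for s
      unfolding y_r0 using that r0 h by (intro y_le) (auto simp: S_def)
  qed (use h in auto)
  then show ?thesis using that r0 f_r0 by auto
qed

text \<open>Two windows of length \<open>h\<close> would both contain limit touching points, which agree modulo \<open>T\<close>;
  as \<open>h < T\<close>, the second window can be chosen strictly inside a period started by the first
  point.\<close>
lemma window_max_touched:
  assumes t0: "\<alpha> + h \<le> t0"
  shows "\<exists>t>t0. u t = M t"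
proof (rule ccontr)
  assume "\<not> (\<exists>t>t0. u t = M t)"
  then have below: "u t < M t" if "t0 < t" for t
    using that M_ge[of t t] t0 h by (auto simp: less_le)
  define L where "L = Inf (M ` {t0<..})"
  have bdd: "bdd_below (M ` {t0<..})"
    using window_max_nonneg_of_below[OF t0 below] by (intro bdd_belowI[of _ 0]) auto
  have L: "(M \<longlongrightarrow> L) at_top"
  proof (rule decreasing_tendsto)
    show "eventually (\<lambda>t. L \<le> M t) at_top"
      using eventually_gt_at_top[of t0]
      by eventually_elim (auto simp: L_def intro!: cInf_lower bdd)
    fix x assume "L < x"
    then obtain t where t: "t0 < t" "M t < x"
      using cInf_lessD[of "M ` {t0<..}" x] by (auto simp: L_def)
    show "eventually (\<lambda>t. M t < x) at_top"
      using eventually_ge_at_top[of t]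
      by eventually_elim (use window_max_antitone[OF t0 below t(1)] t(2) in force)
  qed
  have "t0 + 2 * h < t0 + 3 * h" using h by simp
  then obtain r k q where r: "t0 + 3 * h \<le> r" "r \<le> t0 + 3 * h + h" "f r = - (a + b) * L"
      "r = q + of_int k * T" "0 \<le> q" "q < \<beta>"
    using limit_touches_in_window[OF t0 below L] by metis
  (* With this offset the window of length h is centred in the open interval from r to r + T. *)
  define d where "d = (T - h) / 2"
  have "0 < d" using h by (simp add: d_def)
  have "t0 + 2 * h < r + d" using r(1) h \<open>0 < d\<close> by argo
  then obtain r' k' q' where r': "r + d \<le> r'" "r' \<le> r + d + h" "f r' = - (a + b) * L"
      "r' = q' + of_int k' * T" "0 \<le> q'" "q' < \<beta>"
    using limit_touches_in_window[OF t0 below L] by metis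
  have "q = q'" using falling_phase_unique[OF r(4-6) r'(4-6)] r r' by simp
  moreover have "r < r'" "r' < r + T" using r' h by (auto simp: d_def field_simps)
  ultimately have "of_int k * T < of_int k' * T" "of_int k' * T < (of_int k + 1) * T"
    using r r' by (auto simp: algebra_simps)
  then have "real_of_int k < of_int k'" "real_of_int k' < of_int (k + 1)"
    using T_pos by simp_all
  then have "k < k'" "k' < k + 1" by (simp_all only: of_int_less_iff)
  then show False by simp
qed

section \<open>Peaks never stop\<close>

text \<open>Without further peaks a time at which \<open>u\<close> touches its window maximum is followed only by new
  maxima: the maximum over a later stretch would be a peak if it were not at the right end. So
  \<open>u\<close> is nondecreasing with \<open>u' = (a + b) u + f\<close>. At the zeros of \<open>f\<close> this gives \<open>u \<le> 0\<close>, hence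
  \<open>u \<le> 0\<close> throughout and \<open>u' \<ge> f\<close>, so that \<open>u\<close> grows in each period by at least a fixed amount.\<close>
lemma peak_after:
  assumes t0: "\<alpha> + h \<le> t0"
  shows "\<exists>\<tau>>t0. window_peak h u \<tau>"
proof (rule ccontr)
  assume "\<not> (\<exists>\<tau>>t0. window_peak h u \<tau>)"
  then have no_peak: "\<not> window_peak h u s" if "t0 < s" for s
    using that by blast
  obtain t where t: "t0 < t" "u t = M t" using window_max_touched[OF t0] by blast
  have new_max: "u x \<le> u s" if s: "t \<le> s" and x: "t - h \<le> x" "x \<le> s" for s x
  proof -
    obtain r where r: "r \<in> {t..s}" "\<And>x. x \<in> {t..s} \<Longrightarrow> u x \<le> u r"
      using continuous_attains_sup[of "{t..s}" u] u_cont_on[of t s] t t0 h s by auto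
    have u_r: "u x \<le> u r" if "t - h \<le> x" "x \<le> s" for x
      using r(2)[of x] r(2)[of t] M_ge[of t x] t t0 that s by (cases "x \<le> t") auto
    have "r = s"
    proof (rule ccontr)
      assume "r \<noteq> s"
      have "window_peak h u r"
        using r \<open>r \<noteq> s\<close> t t0 by (subst peak_iff) (auto intro!: exI[of _ "s - r"] u_r)
      then show False using no_peak[of r] r t by auto
    qed
    then show ?thesis using u_r x by blast
  qed
  have deriv: "(u has_real_derivative (a + b) * u s + f s) (at s)" if "t \<le> s" for s
  proof -
    have "M s = u s" using new_max that h by (intro window_max_eqI) auto
    then show ?thesis using u_deriv[of s] that t t0 by (simp add: algebra_simps)
  qed
  have rising: "0 \<le> (a + b) * u s + f s" if "t < s" for s
  proof (rule mono_on_imp_deriv_nonneg[of "{t..}" u])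
    show "mono_on {t..} u" using new_max h by (intro mono_onI) auto
    show "(u has_real_derivative (a + b) * u s + f s) (at s)" using deriv that by simp
  qed (use that in auto)
  have nonpos: "u s \<le> 0" if "t \<le> s" for s
  proof -
    obtain z where z: "f z = 0" using f_zero by blast
    obtain n :: nat where "(s - z) / T < of_nat n" using reals_Archimedean2 by blast
    then have s: "s < z + of_nat n * T" using T_pos by (simp add: field_simps)
    then have "0 \<le> (a + b) * u (z + of_nat n * T)"
      using rising[of "z + of_nat n * T"] z f_shift_nat that by simp
    then have "u (z + of_nat n * T) \<le> 0" using sum_neg by (simp add: zero_le_mult_iff)
    then show ?thesis using new_max[of "z + of_nat n * T" s] s that h by auto
  qed
  (* f is at least c on the first half of each falling phase. *)
  define c where "c = f (\<beta> / 2)"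
  have "0 < c" using f_less_falling[of 0 "\<beta> / 2" \<beta>] f_nonneg[of \<beta>] \<beta> by (simp add: c_def)
  define e where "e = c * (\<beta> / 2)"
  have "0 < e" using \<open>0 < c\<close> \<beta> by (simp add: e_def)
  have growth: "u s + e \<le> u (s + T)" if s: "t \<le> s" "s = of_nat k * T" for s and k :: nat
  proof -
    have "u s - c * s \<le> u (s + \<beta> / 2) - c * (s + \<beta> / 2)"
    proof (rule DERIV_nonneg_imp_nondecreasing[of s "s + \<beta> / 2" "\<lambda>x. u x - c * x"])
      fix x assume x: "s \<le> x" "x \<le> s + \<beta> / 2"
      have "c = f (\<beta> / 2 + s)" using s f_shift_nat by (simp add: c_def)
      also have "\<dots> \<le> f x"
        using f_less_falling[of "int k" x "s + \<beta> / 2"] x s \<beta>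
        by (cases "x = s + \<beta> / 2") (auto simp: add.commute)
      finally have "c \<le> f x" .
      moreover have "0 \<le> (a + b) * u x"
        using sum_neg nonpos[of x] s x by (intro mult_nonpos_nonpos) auto
      moreover have "((\<lambda>x. u x - c * x) has_real_derivative (a + b) * u x + f x - c) (at x)"
        using s x by (auto intro!: derivative_eq_intros deriv)
      ultimately show "\<exists>y. ((\<lambda>x. u x - c * x) has_real_derivative y) (at x) \<and> 0 \<le> y"
        by (intro exI[of _ "(a + b) * u x + f x - c"]) auto
    qed (use \<beta> in auto)
    moreover have "u (s + \<beta> / 2) \<le> u (s + T)" using \<beta> h s by (intro new_max) auto
    ultimately show ?thesis by (simp add: e_def algebra_simps)
  qed
  obtain N :: nat where "t / T < of_nat N" using reals_Archimedean2 by blast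
  then have N: "t \<le> of_nat N * T" using T_pos by (simp add: field_simps)
  have later: "t \<le> of_nat (N + n) * T" for n
    using N T_pos by (simp add: algebra_simps add_increasing2)
  have unbounded: "u (of_nat N * T) + of_nat n * (e) \<le> u (of_nat (N + n) * T)" for n
  proof (induction n)
    case (Suc n)
    have "of_nat (N + n) * T + T = of_nat (N + Suc n) * T" by (simp add: algebra_simps)
    then have "u (of_nat (N + n) * T) + e \<le> u (of_nat (N + Suc n) * T)"
      using growth[OF later refl] by metis
    then show ?case using Suc by (simp add: algebra_simps)
  qed simp
  obtain n :: nat where "- u (of_nat N * T) / (e) < of_nat n"
    using reals_Archimedean2 by blast
  then have "- u (of_nat N * T) < of_nat n * (e)"
    using \<open>0 < e\<close> by (simp add: field_simps)
  then show False using unbounded[of n] nonpos[OF later[of n]] by linarith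
qed

end

theorem lemma6:
  fixes a b h T \<beta> \<alpha> :: real and f u :: "real \<Rightarrow> real"
  assumes "0 < h" and "h < T"
    and "(a + b < 0 \<and> a * h \<le> 1) \<or> (b * h < - exp (a * h - 1) \<and> a * h \<ge> 1)"
    and "continuous_on UNIV f"
    and "\<forall>t. f (t + T) = f t"
    and "0 < \<beta>" and "\<beta> < T"
    and "strict_antimono_on {0..\<beta>} f"
    and "strict_mono_on {\<beta>..T} f"
    and "(\<exists>t. f t = 0) \<and> (\<forall>t. 0 \<le> f t)"
    and "is_solution a b h f \<alpha> u"
  shows "\<exists>\<tau> :: nat \<Rightarrow> real.
           strict_mono_on {1..} \<tau> \<and>
           \<tau> ` {1..} = {t. t > \<alpha> + h \<and> window_peak h u t} \<and>
           \<not> bdd_above (\<tau> ` {1..}) \<and>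
           (\<forall>n\<ge>1. u (\<tau> n) \<in> K_set a b f \<beta> \<and>
                   (\<forall>j. u (\<tau> (n + j)) = (return_map a b h f \<beta> ^^ j) (u (\<tau> n))))"
proof -
  interpret max_solution a b h T \<beta> f \<alpha> u
    using assms by unfold_locales auto
  define P where "P = {t. t > \<alpha> + h \<and> window_peak h u t}"
  have unbounded: "\<exists>x\<in>P. t < x" for t
  proof -
    obtain \<tau> where "max t (\<alpha> + h) < \<tau>" "window_peak h u \<tau>"
      using peak_after[of "max t (\<alpha> + h)"] by auto
    then show ?thesis by (auto simp: P_def)
  qed
  have "\<exists>\<sigma>::nat \<Rightarrow> real. strict_mono \<sigma> \<and> range \<sigma> = P"
  proof (rule gap_set_enumeration)
    show "0 < min h (T - \<beta>)" using h \<beta> by simp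
    show "min h (T - \<beta>) \<le> t - s" if "s \<in> P" "t \<in> P" "s < t" for s t
      using that peak_gap by (auto simp: P_def)
    show "bdd_below P" by (rule bdd_belowI[of _ "\<alpha> + h"]) (simp add: P_def)
  qed (rule unbounded)
  then obtain \<sigma> :: "nat \<Rightarrow> real" where \<sigma>: "strict_mono \<sigma>" "range \<sigma> = P" by blast
  have next_peak: "return_map a b h f \<beta> (u (\<sigma> n)) = u (\<sigma> (Suc n))" for n
  proof (rule return_map_next_peak)
    have "\<sigma> i \<in> P" for i using \<sigma> by auto
    then show "\<alpha> + h < \<sigma> n" "window_peak h u (\<sigma> n)" "window_peak h u (\<sigma> (Suc n))"
      by (auto simp: P_def)
    show "\<sigma> n < \<sigma> (Suc n)" using \<sigma> by (simp add: strict_mono_less)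
    fix t assume t: "\<sigma> n < t" "window_peak h u t"
    then have "t \<in> P" using \<open>\<alpha> + h < \<sigma> n\<close> by (simp add: P_def)
    then obtain i where "t = \<sigma> i" using \<sigma> by auto
    then show "\<sigma> (Suc n) \<le> t"
      using t \<sigma> by (simp add: strict_mono_less strict_mono_less_eq Suc_le_eq)
  qed
  define \<tau> where "\<tau> n = \<sigma> (n - 1)" for n
  have image: "\<tau> ` {1..} = P"
  proof -
    have "\<sigma> n \<in> \<tau> ` {1..}" for n by (rule image_eqI[of _ _ "Suc n"]) (auto simp: \<tau>_def)
    then show ?thesis using \<sigma> by (auto simp: \<tau>_def)
  qed
  moreover have "strict_mono_on {1..} \<tau>"
    using \<sigma> by (auto simp: \<tau>_def strict_mono_less intro!: strict_mono_onI)
  moreover have "\<not> bdd_above P"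
    using unbounded by (meson bdd_above.E not_le)
  moreover have "u (\<tau> n) \<in> K_set a b f \<beta>" if "1 \<le> n" for n
  proof -
    have "\<tau> n \<in> P" using that by (auto simp flip: image)
    then have x: "\<alpha> + h < \<tau> n" "window_peak h u (\<tau> n)" by (simp_all add: P_def)
    obtain k q where q: "\<tau> n = q + of_int k * T" "0 \<le> q" "q < \<beta>"
      using peak_phase[OF x] by blast
    then show ?thesis
      using peak_value[OF x q(1)] by (auto simp: K_set_def)
  qed
  moreover have "u (\<tau> (n + j)) = (return_map a b h f \<beta> ^^ j) (u (\<tau> n))" if "1 \<le> n" for n j
  proof -
    have "u (\<sigma> (m + j)) = (return_map a b h f \<beta> ^^ j) (u (\<sigma> m))" for m
      by (induction j) (auto simp flip: next_peak)
    from this[of "n - 1"] show ?thesis using that by (simp add: \<tau>_def)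
  qed
  ultimately show ?thesis
    unfolding P_def by (intro exI[of _ \<tau>]) auto
qed

end
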